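(* Let $k \ge 2$ and $n \ge 1$ be integers, and let $d = \lceil 2\log_2(n) \rceil$. Every $k$-ary tree of height at most $\log_k(n)$ is contained as a subgraph in the uniformly stacked triangulation $S_d$.
   Context: The uniformly stacked triangulation $S_d$ of depth $d\in\mathbb{N}$ is defined inductively: $S_0$ is a triangle on three fixed non-collinear points $o_1,o_2,o_3$ in the plane; for $d>0$, $S_d$ is obtained from $S_{d-1}$ by placing, in the interior of each bounded triangular face of $S_{d-1}$, a new vertex joined to the three vertices of that face. A $k$-ary tree of height $h$ is a rooted tree in which every vertex has exactly $k$ children, except the vertices on level $h$, which are all leaves (the root is on level $0$). Contained as a subgraph means there is an injective map of vertices sending edges to edges. *)

theory Defs
  imports "HOL-Analysis.Analysis"
begin

section \<open>Simple graphs\<close>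

text \<open>A graph is given by its vertex set \<open>V\<close> and its set \<open>E\<close> of two-element edges.\<close>

definition simple_graph :: "'a set \<Rightarrow> 'a set set \<Rightarrow> bool" where
  "simple_graph V E \<longleftrightarrow> (\<forall>e\<in>E. e \<subseteq> V \<and> card e = 2)"

definition walk :: "'a set \<Rightarrow> 'a set set \<Rightarrow> 'a \<Rightarrow> 'a list \<Rightarrow> 'a \<Rightarrow> bool" where
  "walk V E u xs v \<longleftrightarrow> xs \<noteq> [] \<and> hd xs = u \<and> last xs = v \<and> set xs \<subseteq> V \<and>
     successively (\<lambda>x y. {x, y} \<in> E) xs"

definition connected_graph :: "'a set \<Rightarrow> 'a set set \<Rightarrow> bool" where
  "connected_graph V E \<longleftrightarrow> V \<noteq> {} \<and> (\<forall>u\<in>V. \<forall>v\<in>V. \<exists>xs. walk V E u xs v)"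

definition graph_cycle :: "'a set \<Rightarrow> 'a set set \<Rightarrow> 'a list \<Rightarrow> bool" where
  "graph_cycle V E xs \<longleftrightarrow> length xs \<ge> 3 \<and> distinct xs \<and> set xs \<subseteq> V \<and>
     successively (\<lambda>x y. {x, y} \<in> E) xs \<and> {last xs, hd xs} \<in> E"

definition tree :: "'a set \<Rightarrow> 'a set set \<Rightarrow> bool" where
  "tree V E \<longleftrightarrow> simple_graph V E \<and> connected_graph V E \<and> (\<nexists>xs. graph_cycle V E xs)"

definition contained_as_subgraph ::
    "'a set \<Rightarrow> 'a set set \<Rightarrow> 'b set \<Rightarrow> 'b set set \<Rightarrow> bool" where
  "contained_as_subgraph V E V' E' \<longleftrightarrow>
     (\<exists>\<phi>. inj_on \<phi> V \<and> \<phi> ` V \<subseteq> V' \<and> (\<forall>u v. {u, v} \<in> E \<longrightarrow> {\<phi> u, \<phi> v} \<in> E'))"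

section \<open>Rooted \<open>k\<close>-ary trees\<close>

text \<open>The level of a vertex is its distance from the root \<open>r\<close>; it is only meaningful for
  vertices reachable from \<open>r\<close>.\<close>

definition level :: "'a set \<Rightarrow> 'a set set \<Rightarrow> 'a \<Rightarrow> 'a \<Rightarrow> nat" where
  "level V E r v = (LEAST l. \<exists>xs. walk V E r xs v \<and> length xs = Suc l)"

definition children :: "'a set \<Rightarrow> 'a set set \<Rightarrow> 'a \<Rightarrow> 'a \<Rightarrow> 'a set" where
  "children V E r v = {w \<in> V. {v, w} \<in> E \<and> level V E r w = Suc (level V E r v)}"

text \<open>Finiteness is not assumed separately: for \<open>k > 0\<close> the condition \<open>card \<dots> = k\<close> forces
  finitely many children, and no vertex lies beyond level \<open>h\<close>, since those on level \<open>h\<close> are leaves.\<close>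

definition kary_tree :: "nat \<Rightarrow> nat \<Rightarrow> 'a set \<Rightarrow> 'a set set \<Rightarrow> 'a \<Rightarrow> bool" where
  "kary_tree k h V E r \<longleftrightarrow> tree V E \<and> r \<in> V \<and>
     (\<forall>v\<in>V. if level V E r v = h then children V E r v = {}
            else card (children V E r v) = k)"

section \<open>Uniformly stacked triangulations\<close>

text \<open>Edges are drawn as straight segments; a bounded face is a bounded connected component of
  the complement of the drawing, and its vertices are those on its frontier.\<close>

definition drawing :: "(real^2) set set \<Rightarrow> (real^2) set" where
  "drawing E = (\<Union>e\<in>E. convex hull e)"

definition bounded_faces :: "(real^2) set set \<Rightarrow> (real^2) set set" where
  "bounded_faces E = {f \<in> components (- drawing E). bounded f}"

definition face_vertices :: "(real^2) set \<Rightarrow> (real^2) set \<Rightarrow> (real^2) set" where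
  "face_vertices V f = V \<inter> frontier f"

text \<open>\<open>uniformly_stacked o1 o2 o3 d V E\<close> states that \<open>(V, E)\<close> is a uniformly stacked
  triangulation of depth \<open>d\<close> on \<open>o1\<close>, \<open>o2\<close>, \<open>o3\<close>. The position of the new vertex \<open>p f\<close> inside
  the face \<open>f\<close> is arbitrary, hence a relation rather than a function. Faces are open, so \<open>p f \<in> f\<close>
  places \<open>p f\<close> in the interior.\<close>

inductive uniformly_stacked ::
    "real^2 \<Rightarrow> real^2 \<Rightarrow> real^2 \<Rightarrow> nat \<Rightarrow> (real^2) set \<Rightarrow> (real^2) set set \<Rightarrow> bool"
  for o1 o2 o3 where
  triangle:
    "\<not> collinear {o1, o2, o3} \<Longrightarrow>
     uniformly_stacked o1 o2 o3 0 {o1, o2, o3} {{o1, o2}, {o2, o3}, {o3, o1}}"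
| stack:
    "uniformly_stacked o1 o2 o3 d V E \<Longrightarrow>
     (\<And>f. f \<in> bounded_faces E \<Longrightarrow> p f \<in> f) \<Longrightarrow>
     uniformly_stacked o1 o2 o3 (Suc d)
       (V \<union> p ` bounded_faces E)
       (E \<union> {{p f, v} | f v. f \<in> bounded_faces E \<and> v \<in> face_vertices V f})"

lemma uniformly_stacked_exists:
  assumes "\<not> collinear {o1, o2, o3}"
  shows "\<exists>V E. uniformly_stacked o1 o2 o3 d V E"
proof (induction d)
  case 0
  show ?case using uniformly_stacked.triangle[OF assms] by blast
next
  case (Suc d)
  then obtain V E where VE: "uniformly_stacked o1 o2 o3 d V E" by blast
  have "(SOME x. x \<in> f) \<in> f" if "f \<in> bounded_faces E" for f
    using that in_components_nonempty[of f] by (auto simp: bounded_faces_def some_in_eq)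
  from uniformly_stacked.stack[OF VE this] show ?case by blast
qed

end

theory Submission
  imports Defs
begin

text \<open>By induction on the depth, every bounded face is an open triangle whose sides are edges, and
  stacking splits it into three such triangles. Inside a face with corner \<open>v\<close>, stacking \<open>i\<close> times
  creates \<open>2 ^ i - 1\<close> new neighbours of \<open>v\<close>, to which one can assign pairwise distinct faces, each
  having \<open>v\<close> and the neighbour as corners. If \<open>k < 2 ^ i\<close>, then \<open>k\<close> of these neighbours serve as the
  children of \<open>v\<close>, and the subtree below each child is embedded recursively in its face; hence depth
  \<open>h * i\<close> suffices for height \<open>h\<close>. Choosing \<open>i\<close> with \<open>k < 2 ^ i \<le> k ^ 2\<close> gives
  \<open>h * i \<le> 2 * h * log 2 k \<le> 2 * log 2 n\<close>.\<close>

section \<open>Triangular faces\<close>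

lemma frontier_triangle2:
  fixes a b c :: "real^2"
  shows "frontier (convex hull {a,b,c}) = convex hull {a,b} \<union> convex hull {b,c} \<union> convex hull {c,a}"
  using frontier_of_triangle[of a b c] by (simp add: segment_convex_hull)

lemma interior_triangle_nonempty:
  fixes a b c :: "real^2"
  assumes "\<not> collinear {a,b,c}"
  shows "interior (convex hull {a,b,c}) \<noteq> {}"
proof -
  have "(1/3) *\<^sub>R a + (1/3) *\<^sub>R b + (1/3) *\<^sub>R c \<in> interior (convex hull {a,b,c})"
    unfolding interior_convex_hull_3_minimal[OF assms, simplified] mem_Collect_eq
    by (intro exI[of _ "1/3"] conjI) auto
  then show ?thesis by blast
qed

lemma closed_triangle: "closed (convex hull {a,b,c::real^2})"
  by (simp add: compact_convex_hull compact_imp_closed finite_imp_compact)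

lemma closure_interior_triangle:
  fixes a b c :: "real^2"
  assumes "\<not> collinear {a,b,c}"
  shows "closure (interior (convex hull {a,b,c})) = convex hull {a,b,c}"
  using convex_closure_interior[OF convex_convex_hull interior_triangle_nonempty[OF assms]]
    closed_triangle[of a b c] by simp

lemma frontier_interior_triangle:
  fixes a b c :: "real^2"
  assumes "\<not> collinear {a,b,c}"
  shows "frontier (interior (convex hull {a,b,c})) = frontier (convex hull {a,b,c})"
  using closure_interior_triangle[OF assms] closed_triangle[of a b c] by (simp add: frontier_def)

text \<open>A connected set meeting both \<open>C\<close> and its complement meets the frontier of
  \<open>C\<close>, which lies outside \<open>S\<close>; so \<open>C\<close> cannot be enlarged
  within \<open>S\<close>.\<close>

lemma component_if_frontier_subset:
  assumes "connected C" "C \<noteq> {}" "C \<subseteq> S" "frontier C \<inter> S = {}"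
  shows "C \<in> components S"
  unfolding in_components_maximal
proof (intro conjI allI impI)
  fix D assume D: "D \<noteq> {} \<and> C \<subseteq> D \<and> D \<subseteq> S \<and> connected D"
  then have "D - C = {}" using connected_Int_frontier[of D C] assms by blast
  then show "D = C" using D by blast
qed (use assms in auto)

text \<open>In the barycentric expression of \<open>q\<close> the coefficient of \<open>c\<close> is
  positive, so one can solve for \<open>c\<close>; a line through \<open>a\<close>,
  \<open>b\<close>, \<open>q\<close> would then contain \<open>c\<close>.\<close>

lemma not_collinear_interior_point:
  fixes a b c q :: "real^2"
  assumes nc: "\<not> collinear {a,b,c}" and q: "q \<in> interior (convex hull {a,b,c})"
  shows "\<not> collinear {a,b,q}"
proof
  assume "collinear {a,b,q}"
  then obtain u v where uv: "{a,b,q} \<subseteq> affine hull {u,v}" unfolding collinear_affine_hull by blast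
  obtain x y z where xyz: "0 < x" "0 < y" "0 < z" "x + y + z = 1" "x *\<^sub>R a + y *\<^sub>R b + z *\<^sub>R c = q"
    using q unfolding interior_convex_hull_3_minimal[OF nc, simplified] by blast
  have "c = (1/z) *\<^sub>R (z *\<^sub>R c)" using xyz by simp
  also have "z *\<^sub>R c = q - x *\<^sub>R a - y *\<^sub>R b" using xyz(5) by (auto simp: algebra_simps)
  finally have c: "c = (-x/z) *\<^sub>R a + (-y/z) *\<^sub>R b + (1/z) *\<^sub>R q" by (simp add: algebra_simps)
  have "-x/z + -y/z + 1/z = 1" using xyz by (simp add: field_simps)
  then have "c \<in> affine hull {a,b,q}" unfolding affine_hull_3 using c by blast
  also have "\<dots> \<subseteq> affine hull {u,v}" using uv by (simp add: hull_minimal)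
  finally have "{a,b,c} \<subseteq> affine hull {u,v}" using uv by auto
  then show False using nc unfolding collinear_affine_hull by blast
qed

text \<open>This is the exchange property of affinely independent points. It keeps a new edge from
  \<open>q\<close> to \<open>c\<close> out of the interior of the subtriangle on \<open>a\<close>,
  \<open>b\<close>, \<open>q\<close>.\<close>

lemma triangle_exchange_Int:
  fixes a b c q :: "real^2"
  assumes nc: "\<not> collinear {a,b,c}" and q: "q \<in> interior (convex hull {a,b,c})"
  shows "convex hull {q,c} \<inter> convex hull {a,b,q} = {q}"
proof -
  have "\<not> affine_dependent {a,b,c}" "c \<notin> {a,b}"
    using nc by (auto simp: collinear_3_eq_affine_dependent)
  moreover have "q \<in> convex hull {a,b,c}" using q interior_subset by blast
  ultimately have "convex hull (insert q {c}) \<inter> convex hull (insert q {a,b})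
      = convex hull (insert q ({c} \<inter> {a,b}))"
    by (intro convex_hull_exchange_Int) auto
  moreover have "{c} \<inter> {a,b} = {}" using \<open>c \<notin> {a,b}\<close> by auto
  ultimately show ?thesis by (simp add: insert_commute)
qed

section \<open>Bounded faces that are triangles\<close>

text \<open>The corners are separate arguments so that one of them can be distinguished.
  Intersecting \<open>V\<close> with the closed triangle rules out further vertices on the sides, so
  that \<open>face_vertices\<close> yields the corners only.\<close>

definition triangular_face where
  "triangular_face V E f a b c \<longleftrightarrow> f \<in> bounded_faces E \<and> \<not> collinear {a,b,c} \<and>
     f = interior (convex hull {a,b,c}) \<and> V \<inter> convex hull {a,b,c} = {a,b,c} \<and>
     {a,b} \<in> E \<and> {b,c} \<in> E \<and> {c,a} \<in> E"

lemma triangular_face_mem: "triangular_face V E f a b c \<Longrightarrow> f \<in> bounded_faces E"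
  unfolding triangular_face_def by blast

lemma triangular_face_vertex: "triangular_face V E f a b c \<Longrightarrow> {a,b,c} \<subseteq> V"
  unfolding triangular_face_def by blast

lemma triangular_face_rotate:
  "triangular_face V E f a b c \<Longrightarrow> triangular_face V E f b c a"
  unfolding triangular_face_def by (metis insert_commute)

lemma triangular_face_swap:
  "triangular_face V E f a b c \<Longrightarrow> triangular_face V E f b a c"
  unfolding triangular_face_def by (metis insert_commute)

lemma triangular_face_closure:
  "triangular_face V E f a b c \<Longrightarrow> closure f = convex hull {a,b,c}"
  unfolding triangular_face_def using closure_interior_triangle by auto

lemma triangular_face_frontier:
  assumes "triangular_face V E f a b c"
  shows "frontier f = convex hull {a,b} \<union> convex hull {b,c} \<union> convex hull {c,a}"
  using assms unfolding triangular_face_def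
  by (metis frontier_interior_triangle frontier_triangle2)

lemma triangular_face_frontier_subset:
  "triangular_face V E f a b c \<Longrightarrow> frontier f \<subseteq> drawing E"
  using triangular_face_frontier[of V E f a b c]
  unfolding triangular_face_def drawing_def by blast

lemma triangular_face_vertices:
  assumes "triangular_face V E f a b c"
  shows "face_vertices V f = {a,b,c}"
proof
  have "frontier f \<subseteq> convex hull {a,b,c}"
    using triangular_face_closure[OF assms] by (auto simp: frontier_def)
  then show "face_vertices V f \<subseteq> {a,b,c}"
    using assms unfolding triangular_face_def face_vertices_def by blast
  have "{a,b,c} \<subseteq> frontier f"
    unfolding triangular_face_frontier[OF assms] by (auto intro: hull_inc)
  then show "{a,b,c} \<subseteq> face_vertices V f"
    using assms unfolding triangular_face_def face_vertices_def by blast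
qed

lemma triangular_face_open: "triangular_face V E f a b c \<Longrightarrow> open f"
  unfolding triangular_face_def by auto

lemma bounded_face_drawing_disjoint:
  "f \<in> bounded_faces E \<Longrightarrow> f \<inter> drawing E = {}"
  unfolding bounded_faces_def using in_components_subset by blast

lemma bounded_faces_disjoint:
  "f \<in> bounded_faces E \<Longrightarrow> g \<in> bounded_faces E \<Longrightarrow> f \<noteq> g \<Longrightarrow> f \<inter> g = {}"
  unfolding bounded_faces_def using components_nonoverlap by blast

lemma bounded_face_nonempty: "f \<in> bounded_faces E \<Longrightarrow> f \<noteq> {}"
  unfolding bounded_faces_def using in_components_nonempty by blast

text \<open>The invariant of stacking. Faces avoid the drawing, so
  \<open>V \<subseteq> drawing E\<close> keeps all vertices out of the faces.\<close>

definition triangulated where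
  "triangulated V E \<longleftrightarrow> V \<subseteq> drawing E \<and> (\<forall>f\<in>bounded_faces E. \<exists>a b c. triangular_face V E f a b c)"

lemma triangulatedD:
  assumes "triangulated V E" "f \<in> bounded_faces E"
  obtains a b c where "triangular_face V E f a b c"
  using assms unfolding triangulated_def by blast

lemma bounded_face_open: "triangulated V E \<Longrightarrow> f \<in> bounded_faces E \<Longrightarrow> open f"
  by (meson triangulatedD triangular_face_open)

lemma vertex_notin_face:
  "triangulated V E \<Longrightarrow> f \<in> bounded_faces E \<Longrightarrow> v \<in> V \<Longrightarrow> v \<notin> f"
  unfolding triangulated_def using bounded_face_drawing_disjoint by blast

lemma triangle_bounded_face:
  fixes a b c :: "real^2"
  assumes nc: "\<not> collinear {a,b,c}" and E: "{a,b} \<in> E" "{b,c} \<in> E" "{c,a} \<in> E"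
    and disj: "interior (convex hull {a,b,c}) \<inter> drawing E = {}"
  shows "interior (convex hull {a,b,c}) \<in> bounded_faces E"
proof -
  let ?f = "interior (convex hull {a,b,c})"
  have "frontier ?f \<subseteq> drawing E"
    unfolding frontier_interior_triangle[OF nc] frontier_triangle2 drawing_def using E by blast
  then have "?f \<in> components (- drawing E)"
    using disj interior_triangle_nonempty[OF nc]
    by (intro component_if_frontier_subset convex_connected convex_interior convex_convex_hull) auto
  moreover have "bounded ?f"
    by (meson bounded_convex_hull bounded_subset finite_imp_bounded finite.intros interior_subset)
  ultimately show ?thesis unfolding bounded_faces_def by blast
qed

lemma triangle_triangulated:
  fixes a b c :: "real^2"
  assumes nc: "\<not> collinear {a,b,c}"
  defines "E \<equiv> {{a,b},{b,c},{c,a}}"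
  shows "triangular_face {a,b,c} E (interior (convex hull {a,b,c})) a b c"
    and "triangulated {a,b,c} E"
proof -
  let ?T = "convex hull {a,b,c}"
  have dr: "drawing E = frontier ?T" unfolding drawing_def E_def frontier_triangle2 by auto
  have int: "interior ?T \<in> bounded_faces E"
    by (rule triangle_bounded_face[OF nc]) (auto simp: E_def[symmetric] dr frontier_def, auto simp: E_def)
  have sub: "{a,b,c} \<subseteq> ?T" by (rule hull_subset)
  show tf: "triangular_face {a,b,c} E (interior ?T) a b c"
    unfolding triangular_face_def using int nc sub by (auto simp: E_def)
  \<comment> \<open>Any other bounded face would avoid the closed triangle. The complement of the
    triangle is connected and avoids the drawing, so that face would contain all of it and be
    unbounded.\<close>
  have "f = interior ?T" if f: "f \<in> bounded_faces E" for f
  proof (rule ccontr)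
    assume ne: "f \<noteq> interior ?T"
    have "f \<inter> interior ?T = {}" "f \<inter> drawing E = {}"
      using bounded_faces_disjoint[OF f int ne] bounded_face_drawing_disjoint[OF f] by auto
    then have fT: "f \<subseteq> - ?T" using closed_triangle[of a b c] by (auto simp: dr frontier_def)
    have "bounded ?T" by (simp add: bounded_convex_hull finite_imp_bounded)
    then have "connected (- ?T)"
      by (intro path_connected_imp_connected path_connected_complement_bounded_convex) auto
    moreover have "- ?T \<subseteq> - drawing E" using closed_triangle[of a b c] by (auto simp: dr frontier_def)
    moreover have "f \<in> components (- drawing E)" using f by (simp add: bounded_faces_def)
    ultimately have "- ?T \<subseteq> f"
      using components_maximal fT bounded_face_nonempty[OF f] by blast
    moreover have "bounded f" using f by (simp add: bounded_faces_def)
    ultimately have "bounded (- ?T)" using bounded_subset by blast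
    then show False using \<open>bounded ?T\<close> cobounded_imp_unbounded by blast
  qed
  then show "triangulated {a,b,c} E"
    unfolding triangulated_def dr frontier_triangle2 using tf by (auto intro: hull_inc)
qed

section \<open>One stacking step\<close>

text \<open>The rule \<open>stack\<close> is turned into a relation between consecutive graphs, so
  that a stacking can be treated as a sequence of stages.\<close>

definition stacking_step where
  "stacking_step p V E V' E' \<longleftrightarrow> (\<forall>f\<in>bounded_faces E. p f \<in> f) \<and>
     V' = V \<union> p ` bounded_faces E \<and>
     E' = E \<union> {{p f, v} | f v. f \<in> bounded_faces E \<and> v \<in> face_vertices V f}"

lemma drawing_stacking_step:
  assumes "stacking_step p V E V' E'"
  shows "drawing E' = drawing E \<union> (\<Union>f\<in>bounded_faces E. \<Union>v\<in>face_vertices V f. convex hull {p f, v})"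
  using assms unfolding stacking_step_def drawing_def by blast

text \<open>A closed face is convex and contains both ends. Edges added in one face therefore never
  enter another one.\<close>

lemma new_edge_subset_closure:
  assumes "triangulated V E" "stacking_step p V E V' E'" "f \<in> bounded_faces E" "v \<in> face_vertices V f"
  shows "convex hull {p f, v} \<subseteq> closure f"
proof -
  obtain a b c where t: "triangular_face V E f a b c" using assms triangulatedD by blast
  have "p f \<in> closure f" using assms closure_subset unfolding stacking_step_def by blast
  moreover have "v \<in> closure f" using assms by (auto simp: face_vertices_def frontier_def)
  ultimately show ?thesis
    unfolding triangular_face_closure[OF t] by (simp add: hull_minimal)
qed

lemma bounded_faces_closure_disjoint:
  assumes "triangulated V E" "f \<in> bounded_faces E" "g \<in> bounded_faces E" "f \<noteq> g"
  shows "f \<inter> closure g = {}"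
  using bounded_faces_disjoint[OF assms(2-4)] bounded_face_open[OF assms(1,2)]
    open_Int_closure_eq_empty by blast

text \<open>The open subtriangle lies in \<open>f\<close> and so avoids the old drawing. New edges
  of other faces stay in the closures of those faces, the edges from \<open>p f\<close> to
  \<open>a\<close> and \<open>b\<close> are sides, and the edge to \<open>c\<close> is handled by
  \<open>triangle_exchange_Int\<close>. Rotating the corners covers the other two
  subtriangles.\<close>

lemma triangular_face_stacking_step:
  assumes tr: "triangulated V E" and st: "stacking_step p V E V' E'"
    and t: "triangular_face V E f a b c"
  shows "triangular_face V' E' (interior (convex hull {a, b, p f})) a b (p f)"
proof -
  define q where "q = p f"
  have f: "f \<in> bounded_faces E" and nc: "\<not> collinear {a,b,c}"
    and f_eq: "f = interior (convex hull {a,b,c})" and V: "V \<inter> convex hull {a,b,c} = {a,b,c}"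
    and ab: "{a,b} \<in> E" using t unfolding triangular_face_def by auto
  have q: "q \<in> f" using st f unfolding stacking_step_def q_def by blast
  have q': "q \<in> interior (convex hull {a,b,c})" using q f_eq by simp
  have ncq: "\<not> collinear {a,b,q}" by (rule not_collinear_interior_point[OF nc q'])
  let ?T = "convex hull {a,b,q}"
  have T_sub: "?T \<subseteq> convex hull {a,b,c}"
    using q' interior_subset by (intro hull_minimal) (auto intro: hull_inc)
  have int_sub: "interior ?T \<subseteq> f" unfolding f_eq using T_sub by (rule interior_mono)
  have fr: "interior ?T \<inter> (convex hull {a,b} \<union> convex hull {b,q} \<union> convex hull {q,a}) = {}"
    unfolding frontier_triangle2[symmetric] by (auto simp: frontier_def)
  have qT: "q \<notin> interior ?T" using fr hull_inc[of q "{b,q}" convex] by blast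
  have E': "{q,a} \<in> E'" "{q,b} \<in> E'" "{a,b} \<in> E'"
    using st f ab triangular_face_vertices[OF t] unfolding stacking_step_def q_def by auto
  have "interior ?T \<inter> drawing E = {}" using int_sub bounded_face_drawing_disjoint[OF f] by blast
  moreover have "interior ?T \<inter> convex hull {p g, v} = {}"
    if g: "g \<in> bounded_faces E" and v: "v \<in> face_vertices V g" for g v
  proof (cases "g = f")
    case True
    then have "v \<in> {a,b,c}" using v triangular_face_vertices[OF t] by simp
    then consider "v = a" | "v = b" | "v = c" by blast
    then show ?thesis
    proof cases
      case 3
      have "convex hull {q,c} \<inter> ?T = {q}" by (rule triangle_exchange_Int[OF nc q'])
      then show ?thesis using 3 True qT interior_subset[of ?T] by (auto simp: q_def[symmetric])
    qed (use fr True in \<open>auto simp: q_def[symmetric] insert_commute\<close>)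
  next
    case False
    then show ?thesis
      using new_edge_subset_closure[OF tr st g v] int_sub bounded_faces_closure_disjoint[OF tr f g]
      by blast
  qed
  ultimately have disj: "interior ?T \<inter> drawing E' = {}"
    unfolding drawing_stacking_step[OF st] by blast
  have bf: "interior ?T \<in> bounded_faces E'"
    by (rule triangle_bounded_face[OF ncq]) (use E' disj in \<open>auto simp: insert_commute\<close>)
  \<comment> \<open>By the exchange property \<open>c\<close> could only coincide with
    \<open>q\<close>, but \<open>q\<close> lies in the open face and \<open>c\<close> is an old
    vertex.\<close>
  have cT: "c \<notin> ?T"
  proof
    assume "c \<in> ?T"
    then have "c = q"
      using triangle_exchange_Int[OF nc q'] hull_inc[of c "{q,c}" convex] by blast
    moreover have "c \<in> V" using V by blast
    ultimately show False using vertex_notin_face[OF tr f] q by blast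
  qed
  have "V' \<inter> ?T \<subseteq> {a,b,q}"
  proof
    fix x assume x: "x \<in> V' \<inter> ?T"
    then consider "x \<in> V" | g where "g \<in> bounded_faces E" "x = p g"
      using st unfolding stacking_step_def by blast
    then show "x \<in> {a,b,q}"
    proof cases
      case 1
      then have "x \<in> {a,b,c}" using V x T_sub by blast
      then show ?thesis using x cT by blast
    next
      case 2
      have "x \<in> closure f" using triangular_face_closure[OF t] x T_sub by blast
      moreover have "x \<in> g" using 2 st unfolding stacking_step_def by blast
      ultimately have "g = f" using bounded_faces_closure_disjoint[OF tr 2(1) f] by blast
      then show ?thesis using 2 q_def by blast
    qed
  qed
  moreover have "{a,b,q} \<subseteq> V'" using V st f unfolding stacking_step_def q_def by blast
  moreover have "{a,b,q} \<subseteq> ?T" by (rule hull_subset)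
  ultimately show ?thesis
    unfolding triangular_face_def q_def[symmetric] using bf ncq E' by (auto simp: insert_commute)
qed

text \<open>Every new face lies in an old bounded face and meets one of its three subtriangles.
  Their interiors are faces already, and distinct faces are disjoint.\<close>

lemma triangulated_stacking_step:
  assumes tr: "triangulated V E" and st: "stacking_step p V E V' E'"
  shows "triangulated V' E'"
  unfolding triangulated_def
proof (intro conjI ballI subsetI)
  fix x assume "x \<in> V'"
  then consider "x \<in> V" | f where "f \<in> bounded_faces E" "x = p f"
    using st unfolding stacking_step_def by blast
  then show "x \<in> drawing E'"
  proof cases
    case 1
    then show ?thesis using tr drawing_stacking_step[OF st] unfolding triangulated_def by blast
  next
    case 2
    obtain a b c where t: "triangular_face V E f a b c" using triangulatedD[OF tr 2(1)] .
    have "a \<in> face_vertices V f" using triangular_face_vertices[OF t] by blast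
    moreover have "x \<in> convex hull {p f, a}" unfolding 2 by (auto intro: hull_inc)
    ultimately show ?thesis unfolding drawing_stacking_step[OF st] using 2 by blast
  qed
next
  fix f' assume f': "f' \<in> bounded_faces E'"
  have comp': "f' \<in> components (- drawing E')" and bd': "bounded f'"
    using f' by (auto simp: bounded_faces_def)
  have ne: "f' \<noteq> {}" and sub: "f' \<subseteq> - drawing E'" and con: "connected f'"
    using comp' in_components_nonempty in_components_subset in_components_connected by blast+
  have sub0: "f' \<subseteq> - drawing E" using sub drawing_stacking_step[OF st] by blast
  then obtain g where g: "g \<in> components (- drawing E)" and f'g: "f' \<subseteq> g"
    using exists_component_superset[OF sub0 _ con] ne by blast
  \<comment> \<open>New edges lie in closures of bounded faces. An unbounded \<open>g\<close> would
    avoid them all, hence still be disjoint from the drawing and be contained in the bounded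
    \<open>f'\<close>.\<close>
  have "bounded g"
  proof (rule ccontr)
    assume unb: "\<not> bounded g"
    have "g \<inter> convex hull {p e, v} = {}" if e: "e \<in> bounded_faces E" and v: "v \<in> face_vertices V e" for e v
    proof -
      obtain a b c where t: "triangular_face V E e a b c" using triangulatedD[OF tr e] .
      have "g \<inter> e = {}"
        using e unb components_nonoverlap[OF g, of e] unfolding bounded_faces_def by blast
      moreover have "g \<inter> frontier e = {}"
        using triangular_face_frontier_subset[OF t] in_components_subset[OF g] by blast
      moreover have "closure e \<subseteq> e \<union> frontier e"
        using interior_subset[of e] by (auto simp: frontier_def)
      ultimately show ?thesis using new_edge_subset_closure[OF tr st e v] by blast
    qed
    then have "g \<subseteq> - drawing E'"
      unfolding drawing_stacking_step[OF st] using in_components_subset[OF g] by blast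
    then have "g \<subseteq> f'"
      using components_maximal[OF comp' in_components_connected[OF g]] ne f'g by blast
    then show False using bd' unb bounded_subset by blast
  qed
  then have gb: "g \<in> bounded_faces E" using g by (simp add: bounded_faces_def)
  obtain a b c where t: "triangular_face V E g a b c" using triangulatedD[OF tr gb] .
  obtain x where x: "x \<in> f'" using ne by blast
  \<comment> \<open>Since \<open>x\<close> is off the new drawing, it lies in the interior of the
    subtriangle, which is a face of \<open>E'\<close> and so must be \<open>f'\<close>.\<close>
  have claim: "\<exists>a b c. triangular_face V' E' f' a b c"
    if t': "triangular_face V E g a b c" and x': "x \<in> convex hull {a,b,p g}" for a b c
  proof -
    note T = triangular_face_stacking_step[OF tr st t']
    have "x \<notin> frontier (interior (convex hull {a,b,p g}))"
      using triangular_face_frontier_subset[OF T] sub x by blast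
    moreover have "x \<in> closure (interior (convex hull {a,b,p g}))"
      using x' triangular_face_closure[OF T] by simp
    ultimately have "x \<in> interior (convex hull {a,b,p g})" by (simp add: frontier_def)
    moreover have "interior (convex hull {a,b,p g}) \<in> bounded_faces E'"
      using T by (simp add: triangular_face_def)
    ultimately have "f' = interior (convex hull {a,b,p g})"
      using bounded_faces_disjoint[OF f'] x by blast
    then show ?thesis using T by blast
  qed
  have "p g \<in> convex hull {a,b,c}"
    using t st gb interior_subset unfolding stacking_step_def triangular_face_def by blast
  moreover have "x \<in> convex hull {a,b,c}"
    using x f'g t interior_subset unfolding triangular_face_def by blast
  \<comment> \<open>Replacing a suitable corner by \<open>p g\<close> keeps \<open>x\<close> in the
    hull: the three subtriangles cover the triangle.\<close>
  ultimately obtain s where s: "s \<in> {a,b,c}" "x \<in> convex hull (insert (p g) ({a,b,c} - {s}))"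
    by (rule in_convex_hull_exchange)
  have "insert (p g) ({a,b,c} - {c}) \<subseteq> {a,b,p g}" "insert (p g) ({a,b,c} - {a}) \<subseteq> {b,c,p g}"
    "insert (p g) ({a,b,c} - {b}) \<subseteq> {c,a,p g}" by auto
  then have "x \<in> convex hull {a,b,p g} \<or> x \<in> convex hull {b,c,p g} \<or> x \<in> convex hull {c,a,p g}"
    using s hull_mono[of "insert (p g) ({a,b,c} - {c})" "{a,b,p g}" convex]
      hull_mono[of "insert (p g) ({a,b,c} - {a})" "{b,c,p g}" convex]
      hull_mono[of "insert (p g) ({a,b,c} - {b})" "{c,a,p g}" convex] by blast
  then show "\<exists>a b c. triangular_face V' E' f' a b c"
    using claim[OF t] claim[OF triangular_face_rotate[OF t]]
      claim[OF triangular_face_rotate[OF triangular_face_rotate[OF t]]] by blast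
qed

section \<open>Embedding the tree of addresses\<close>

text \<open>Two of the three subtriangles retain the corner \<open>v\<close>; they share the side
  from \<open>v\<close> to the new vertex. Each step thus doubles the number of faces at
  \<open>v\<close> inside \<open>f\<close>.\<close>

lemma triangular_face_split:
  assumes tr: "triangulated V E" and st: "stacking_step p V E V' E'"
    and t: "triangular_face V E f v a b"
  obtains q f1 f2 where "q \<in> f" "triangular_face V' E' f1 v a q" "triangular_face V' E' f2 v q b"
    "f1 \<subseteq> f" "f2 \<subseteq> f" "f1 \<inter> f2 = {}"
proof
  let ?q = "p f"
  let ?f1 = "interior (convex hull {v,a,?q})" and ?f2 = "interior (convex hull {b,v,?q})"
  show q: "?q \<in> f" using st triangular_face_mem[OF t] unfolding stacking_step_def by blast
  show 1: "triangular_face V' E' ?f1 v a ?q" by (rule triangular_face_stacking_step[OF tr st t])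
  have "triangular_face V E f b v a" by (rule triangular_face_rotate[OF triangular_face_rotate[OF t]])
  from triangular_face_stacking_step[OF tr st this]
  show 2: "triangular_face V' E' ?f2 v ?q b" by (rule triangular_face_rotate)
  have f: "f = interior (convex hull {v,a,b})" using t unfolding triangular_face_def by blast
  have qT: "?q \<in> convex hull {v,a,b}" using q f interior_subset by blast
  have "convex hull {v,a,?q} \<subseteq> convex hull {v,a,b}" "convex hull {b,v,?q} \<subseteq> convex hull {v,a,b}"
    using qT by (simp_all add: hull_minimal hull_inc)
  then show "?f1 \<subseteq> f" "?f2 \<subseteq> f"
    using interior_mono[of "convex hull {v,a,?q}" "convex hull {v,a,b}"]
      interior_mono[of "convex hull {b,v,?q}" "convex hull {v,a,b}"] f by blast+
  \<comment> \<open>A face determines its corners, and \<open>a\<close> is a corner of the first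
    part only.\<close>
  have "?f1 \<noteq> ?f2"
  proof
    assume "?f1 = ?f2"
    then have "{v,a,?q} = {v,?q,b}"
      using triangular_face_vertices[OF 1] triangular_face_vertices[OF 2] by simp
    moreover have "a \<noteq> ?q"
      using q triangular_face_vertex[OF t] vertex_notin_face[OF tr triangular_face_mem[OF t]] by blast
    moreover have "a \<noteq> v" "a \<noteq> b" using t unfolding triangular_face_def by auto
    ultimately show False by blast
  qed
  then show "?f1 \<inter> ?f2 = {}"
    using bounded_faces_disjoint triangular_face_mem[OF 1] triangular_face_mem[OF 2] by blast
qed

text \<open>All intermediate stages are kept because the recursive embedding has to start in a face
  of an arbitrary stage \<open>t\<close>, not only in the initial triangle.\<close>

locale stacking =
  fixes Vs :: "nat \<Rightarrow> (real^2) set" and Es :: "nat \<Rightarrow> (real^2) set set" and d :: nat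
  assumes triangulated_0: "triangulated (Vs 0) (Es 0)"
    and step: "t < d \<Longrightarrow> \<exists>p. stacking_step p (Vs t) (Es t) (Vs (Suc t)) (Es (Suc t))"
begin

lemma triangulated: "t \<le> d \<Longrightarrow> triangulated (Vs t) (Es t)"
proof (induction t)
  case (Suc t)
  then show ?case using step[of t] triangulated_stacking_step by fastforce
qed (rule triangulated_0)

lemma mono:
  assumes "s \<le> t" "t \<le> d"
  shows "Vs s \<subseteq> Vs t \<and> Es s \<subseteq> Es t"
  using assms
proof (induction t rule: dec_induct)
  case (step t)
  then have "Vs t \<subseteq> Vs (Suc t) \<and> Es t \<subseteq> Es (Suc t)"
    using stacking.step[OF stacking_axioms, of t] unfolding stacking_step_def by auto
  then show ?case using step by auto
qed simp

text \<open>Each of the \<open>2 ^ i\<close> faces at \<open>v\<close> inside \<open>f\<close> is assigned to its side \<open>{v, x}\<close> nearer to \<open>{v, a}\<close>;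
  the vertex \<open>a\<close> itself is included only to make the induction work.\<close>

lemma face_fan:
  assumes "t + i \<le> d" "triangular_face (Vs t) (Es t) f v a b"
  shows "\<exists>X g. a \<in> X \<and> card X = 2 ^ i \<and> X \<subseteq> insert a f \<and> inj_on g X \<and>
    (\<forall>x\<in>X. g x \<subseteq> f \<and> (\<exists>w. triangular_face (Vs (t + i)) (Es (t + i)) (g x) v x w))"
  using assms
proof (induction i arbitrary: t f a b)
  case 0
  then show ?case by (intro exI[of _ "{a}"] exI[of _ "\<lambda>_. f"]) auto
next
  case (Suc i)
  have tr: "triangulated (Vs t) (Es t)" and tr': "triangulated (Vs (Suc t)) (Es (Suc t))"
    using Suc.prems triangulated by auto
  obtain p where st: "stacking_step p (Vs t) (Es t) (Vs (Suc t)) (Es (Suc t))"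
    using step[of t] Suc.prems by auto
  obtain q f1 f2 where q: "q \<in> f"
    and f1: "triangular_face (Vs (Suc t)) (Es (Suc t)) f1 v a q" "f1 \<subseteq> f"
    and f2: "triangular_face (Vs (Suc t)) (Es (Suc t)) f2 v q b" "f2 \<subseteq> f"
    and disj: "f1 \<inter> f2 = {}"
    using triangular_face_split[OF tr st Suc.prems(2)] by metis
  have le: "Suc t + i \<le> d" using Suc.prems by simp
  \<comment> \<open>The fan in \<open>f1\<close> is based at \<open>a\<close> and the one in
    \<open>f2\<close> at the new vertex \<open>q\<close>, so \<open>a\<close> remains the only
    member outside \<open>f\<close>.\<close>
  obtain X1 g1 where X1: "a \<in> X1" "card X1 = 2 ^ i" "X1 \<subseteq> insert a f1" "inj_on g1 X1"
    "\<And>x. x \<in> X1 \<Longrightarrow> g1 x \<subseteq> f1 \<and>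
       (\<exists>w. triangular_face (Vs (Suc t + i)) (Es (Suc t + i)) (g1 x) v x w)"
    using Suc.IH[OF le f1(1)] by blast
  obtain X2 g2 where X2: "q \<in> X2" "card X2 = 2 ^ i" "X2 \<subseteq> insert q f2" "inj_on g2 X2"
    "\<And>x. x \<in> X2 \<Longrightarrow> g2 x \<subseteq> f2 \<and>
       (\<exists>w. triangular_face (Vs (Suc t + i)) (Es (Suc t + i)) (g2 x) v x w)"
    using Suc.IH[OF le f2(1)] by blast
  have "a \<notin> f"
    using vertex_notin_face[OF tr triangular_face_mem[OF Suc.prems(2)]]
      triangular_face_vertex[OF Suc.prems(2)] by blast
  moreover have "q \<notin> f1"
    using vertex_notin_face[OF tr' triangular_face_mem[OF f1(1)]]
      triangular_face_vertex[OF f1(1)] by blast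
  ultimately have XX: "X1 \<inter> X2 = {}" using X1(3) X2(3) disj q f2(2) by blast
  define g where "g x = (if x \<in> X1 then g1 x else g2 x)" for x
  have g1: "g x = g1 x" if "x \<in> X1" for x using that by (simp add: g_def)
  have g2: "g x = g2 x" if "x \<in> X2" for x using that XX by (auto simp: g_def)
  have cross: "g1 x \<noteq> g2 y" if "x \<in> X1" "y \<in> X2" for x y
  proof -
    have "g1 x \<noteq> {}" using X1(5)[OF that(1)] triangular_face_mem bounded_face_nonempty by blast
    then show ?thesis using X1(5)[OF that(1)] X2(5)[OF that(2)] disj by blast
  qed
  have "inj_on g X1" "inj_on g X2" using X1(4) X2(4) g1 g2 inj_on_cong by metis+
  moreover have "g ` X1 \<inter> g ` X2 = {}" using cross g1 g2 by auto
  ultimately have "inj_on g (X1 \<union> X2)" unfolding inj_on_Un by blast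
  moreover have "finite X1" "finite X2" using X1(2) X2(2) by (metis card.infinite power_not_zero zero_neq_numeral)+
  then have "card (X1 \<union> X2) = 2 ^ Suc i" using XX X1(2) X2(2) by (simp add: card_Un_disjoint)
  moreover have "X1 \<union> X2 \<subseteq> insert a f" using X1(3) X2(3) f1(2) f2(2) q by blast
  moreover have "g x \<subseteq> f \<and> (\<exists>w. triangular_face (Vs (t + Suc i)) (Es (t + Suc i)) (g x) v x w)"
    if x: "x \<in> X1 \<union> X2" for x
  proof (cases "x \<in> X1")
    case True
    then show ?thesis using X1(5)[OF True] f1(2) by (auto simp: g1)
  next
    case False
    then have "x \<in> X2" using x by blast
    then show ?thesis using X2(5)[of x] f2(2) by (auto simp: g2)
  qed
  ultimately show ?case using X1(1) by (intro exI[of _ "X1 \<union> X2"] exI[of _ g]) blast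
qed

text \<open>Lists over \<open>{..<k}\<close> are the addresses of the full \<open>k\<close>-ary
  tree. Stage and face are arbitrary for the induction on \<open>h\<close>. Confining the images to
  \<open>insert v f\<close> is what separates the subtrees of different children.\<close>

lemma address_tree_embedding:
  fixes k i h :: nat
  assumes k: "k < 2 ^ i"
  shows "t + h * i \<le> d \<Longrightarrow> triangular_face (Vs t) (Es t) f v a b \<Longrightarrow>
    \<exists>\<phi>. \<phi> [] = v \<and> inj_on \<phi> {xs. set xs \<subseteq> {..<k} \<and> length xs \<le> h} \<and>
      (\<forall>xs. set xs \<subseteq> {..<k} \<and> length xs \<le> h \<longrightarrow> \<phi> xs \<in> insert v f \<inter> Vs (t + h * i)) \<and>
      (\<forall>xs j. set (xs @ [j]) \<subseteq> {..<k} \<and> length (xs @ [j]) \<le> h \<longrightarrow>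
         {\<phi> xs, \<phi> (xs @ [j])} \<in> Es (t + h * i))"
proof (induction h arbitrary: t f v a b)
  case 0
  then show ?case
    using triangular_face_vertex[OF 0(2)] by (intro exI[of _ "\<lambda>_. v"]) (auto simp: inj_on_def)
next
  case (Suc h)
  define D where "D = t + Suc h * i"
  have D: "D = (t + i) + h * i" "D \<le> d" using Suc.prems by (auto simp: D_def)
  have tr: "triangulated (Vs t) (Es t)" and tr': "triangulated (Vs (t + i)) (Es (t + i))"
    using D triangulated by auto
  have vf: "v \<notin> f" "v \<in> Vs t"
    using vertex_notin_face[OF tr triangular_face_mem[OF Suc.prems(2)]]
      triangular_face_vertex[OF Suc.prems(2)] by blast+
  obtain X g where X: "a \<in> X" "card X = 2 ^ i" "X \<subseteq> insert a f" "inj_on g X"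
    "\<And>x. x \<in> X \<Longrightarrow> g x \<subseteq> f"
    "\<And>x. x \<in> X \<Longrightarrow> \<exists>w. triangular_face (Vs (t + i)) (Es (t + i)) (g x) v x w"
    using face_fan[OF _ Suc.prems(2), of i] D
    by (metis (no_types, lifting) add_leD1)
  \<comment> \<open>The base neighbour \<open>a\<close> lies outside \<open>f\<close> and is
    dropped; since \<open>k < 2 ^ i\<close>, at least \<open>k\<close> candidates for children
    remain.\<close>
  have "k \<le> card (X - {a})" using X(1,2) k by (simp add: card_Diff_singleton)
  moreover have "finite X" using X(2) by (metis card.infinite power_not_zero zero_neq_numeral)
  ultimately obtain x where x: "inj_on x {..<k}" "x ` {..<k} \<subseteq> X - {a}"
    using card_le_inj[of "{..<k}" "X - {a}"] by auto
  have xX: "x j \<in> X" "x j \<in> f" if "j < k" for j using x(2) X(3) that by blast+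
  \<comment> \<open>Swapping corners puts the child first, as the corner from which its own subtree
    grows.\<close>
  have "\<exists>w. triangular_face (Vs (t + i)) (Es (t + i)) (g (x j)) (x j) v w" if "j < k" for j
    using X(6)[OF xX(1)[OF that]] triangular_face_swap by blast
  then obtain w where w: "\<And>j. j < k \<Longrightarrow>
      triangular_face (Vs (t + i)) (Es (t + i)) (g (x j)) (x j) v (w j)" by metis
  have xV: "x j \<in> Vs (t + i)" if "j < k" for j using triangular_face_vertex[OF w[OF that]] by blast
  \<comment> \<open>The conclusion of the induction hypothesis for child \<open>j\<close> gets a
    name so that embeddings can be chosen for all \<open>j\<close> at once.\<close>
  define Q where "Q j \<phi> \<longleftrightarrow> \<phi> [] = x j \<and> inj_on \<phi> {xs. set xs \<subseteq> {..<k} \<and> length xs \<le> h} \<and>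
      (\<forall>xs. set xs \<subseteq> {..<k} \<and> length xs \<le> h \<longrightarrow> \<phi> xs \<in> insert (x j) (g (x j)) \<inter> Vs D) \<and>
      (\<forall>xs l. set (xs @ [l]) \<subseteq> {..<k} \<and> length (xs @ [l]) \<le> h \<longrightarrow>
         {\<phi> xs, \<phi> (xs @ [l])} \<in> Es D)" for j \<phi>
  have "\<exists>\<phi>. Q j \<phi>" if "j < k" for j
    unfolding Q_def D(1) by (rule Suc.IH[OF _ w[OF that]]) (use D in simp)
  then obtain \<psi> where \<psi>: "\<And>j. j < k \<Longrightarrow> Q j (\<psi> j)" by metis
  have \<psi>_nil: "\<psi> j [] = x j" if "j < k" for j using \<psi>[OF that] unfolding Q_def by blast
  have \<psi>_inj: "xs = ys" if "j < k" "\<psi> j xs = \<psi> j ys" "set xs \<subseteq> {..<k}" "length xs \<le> h"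
    "set ys \<subseteq> {..<k}" "length ys \<le> h" for j xs ys
    using \<psi>[OF that(1)] that(2-) unfolding Q_def inj_on_def by blast
  have \<psi>_in: "\<psi> j xs \<in> insert (x j) (g (x j))" "\<psi> j xs \<in> Vs D"
    if "j < k" "set xs \<subseteq> {..<k}" "length xs \<le> h" for j xs
    using \<psi>[OF that(1)] that(2-) unfolding Q_def by blast+
  have \<psi>_edge: "{\<psi> j xs, \<psi> j (xs @ [l])} \<in> Es D"
    if "j < k" "set (xs @ [l]) \<subseteq> {..<k}" "length (xs @ [l]) \<le> h" for j xs l
    using \<psi>[OF that(1)] that(2-) unfolding Q_def by blast
  have \<psi>_f: "\<psi> j xs \<in> f" if "j < k" "set xs \<subseteq> {..<k}" "length xs \<le> h" for j xs
    using \<psi>_in(1)[OF that] xX(2)[OF that(1)] X(5)[OF xX(1)[OF that(1)]] by auto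
  \<comment> \<open>Distinct children have distinct and thus disjoint faces, and a child, being a
    vertex of stage \<open>t + i\<close>, lies in no face of that stage.\<close>
  have cross: "insert (x j) (g (x j)) \<inter> insert (x l) (g (x l)) = {}"
    if "j < k" "l < k" "j \<noteq> l" for j l
  proof -
    have ne: "x j \<noteq> x l" using x(1) that by (auto dest: inj_onD)
    then have "g (x j) \<noteq> g (x l)" using X(4) xX that by (auto dest: inj_onD)
    then have "g (x j) \<inter> g (x l) = {}"
      using bounded_faces_disjoint triangular_face_mem w that by metis
    moreover have "x j \<notin> g (x l)" "x l \<notin> g (x j)"
      using vertex_notin_face[OF tr'] triangular_face_mem w xV that by metis+
    ultimately show ?thesis using ne by blast
  qed
  \<comment> \<open>The first index selects the child; the rest of the address is placed by the
    embedding belonging to that child.\<close>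
  define \<phi> where "\<phi> xs = (case xs of [] \<Rightarrow> v | j # ys \<Rightarrow> \<psi> j ys)" for xs
  have \<phi>: "\<phi> [] = v" "\<And>j ys. \<phi> (j # ys) = \<psi> j ys" by (simp_all add: \<phi>_def)
  have "inj_on \<phi> {xs. set xs \<subseteq> {..<k} \<and> length xs \<le> Suc h}"
  proof (rule inj_onI, clarify)
    fix xs ys assume eq: "\<phi> xs = \<phi> ys" and xs: "set xs \<subseteq> {..<k}" "length xs \<le> Suc h"
      and ys: "set ys \<subseteq> {..<k}" "length ys \<le> Suc h"
    show "xs = ys"
    proof (cases xs)
      case Nil
      then show ?thesis using eq ys \<psi>_f vf(1) by (cases ys) (auto simp: \<phi>)
    next
      case (Cons j xs')
      show ?thesis
      proof (cases ys)
        case Nil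
        then show ?thesis using eq xs \<psi>_f vf(1) Cons by (auto simp: \<phi>)
      next
        case (Cons l ys')
        have jl: "j < k" "set xs' \<subseteq> {..<k}" "length xs' \<le> h"
          "l < k" "set ys' \<subseteq> {..<k}" "length ys' \<le> h" and eq': "\<psi> j xs' = \<psi> l ys'"
          using xs ys eq Cons \<open>xs = j # xs'\<close> by (auto simp: \<phi>)
        have "j = l"
        proof (rule ccontr)
          assume "j \<noteq> l"
          then show False
            using cross[OF jl(1,4)] \<psi>_in(1)[OF jl(1-3)] \<psi>_in(1)[OF jl(4-6)] eq'
            by (metis disjoint_iff)
        qed
        then show ?thesis using \<psi>_inj[of j xs' ys'] jl eq' Cons \<open>xs = j # xs'\<close> by simp
      qed
    qed
  qed
  moreover have "\<phi> xs \<in> insert v f \<inter> Vs D" if "set xs \<subseteq> {..<k}" "length xs \<le> Suc h" for xs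
  proof (cases xs)
    case Nil
    have "Vs t \<subseteq> Vs D" using mono[of t D] D by auto
    then show ?thesis using vf Nil \<phi> by auto
  next
    case (Cons j ys)
    then show ?thesis using \<psi>_f[of j ys] \<psi>_in(2)[of j ys] that by (auto simp: \<phi>)
  qed
  moreover have "{\<phi> xs, \<phi> (xs @ [l])} \<in> Es D"
    if "set (xs @ [l]) \<subseteq> {..<k}" "length (xs @ [l]) \<le> Suc h" for xs l
  proof (cases xs)
    case Nil
    then have l: "l < k" using that by simp
    have "{v, x l} \<in> Es (t + i)" using w[OF l] unfolding triangular_face_def by (simp add: insert_commute)
    moreover have "Es (t + i) \<subseteq> Es D" using mono[of "t + i" D] D by auto
    ultimately show ?thesis using Nil \<phi> \<psi>_nil[OF l] by auto
  next
    case (Cons j ys)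
    then show ?thesis using \<psi>_edge[of j ys l] that by (auto simp: \<phi>)
  qed
  ultimately show ?case using \<phi>(1) unfolding D_def[symmetric] by (intro exI[of _ \<phi>]) blast
qed

end

text \<open>The inductive predicate exposes only the last graph; its derivation is unrolled here
  into the sequence of all stages.\<close>

lemma uniformly_stacked_stages:
  assumes "uniformly_stacked o1 o2 o3 d V E"
  obtains Vs Es where "\<not> collinear {o1,o2,o3}"
    "Vs 0 = {o1,o2,o3}" "Es 0 = {{o1,o2},{o2,o3},{o3,o1}}" "Vs d = V" "Es d = E"
    "\<And>t. t < d \<Longrightarrow> \<exists>p. stacking_step p (Vs t) (Es t) (Vs (Suc t)) (Es (Suc t))"
  using assms
proof (induction arbitrary: thesis rule: uniformly_stacked.induct)
  case triangle
  show ?case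
    by (rule triangle.prems[of "\<lambda>_. {o1,o2,o3}" "\<lambda>_. {{o1,o2},{o2,o3},{o3,o1}}"])
      (use triangle.hyps in auto)
next
  case (stack d V E p)
  obtain Vs Es where IH: "\<not> collinear {o1,o2,o3}"
    "Vs 0 = {o1,o2,o3}" "Es 0 = {{o1,o2},{o2,o3},{o3,o1}}" "Vs d = V" "Es d = E"
    "\<And>t. t < d \<Longrightarrow> \<exists>p. stacking_step p (Vs t) (Es t) (Vs (Suc t)) (Es (Suc t))"
    using stack.IH by metis
  define V' where "V' = V \<union> p ` bounded_faces E"
  define E' where "E' = E \<union> {{p f, v} | f v. f \<in> bounded_faces E \<and> v \<in> face_vertices V f}"
  have st: "stacking_step p V E V' E'"
    using stack.hyps unfolding stacking_step_def V'_def E'_def by blast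
  have "\<exists>p. stacking_step p ((Vs(Suc d := V')) t) ((Es(Suc d := E')) t)
      ((Vs(Suc d := V')) (Suc t)) ((Es(Suc d := E')) (Suc t))" if "t < Suc d" for t
    using that IH(4-6) st by (cases "t = d") auto
  then show ?case
    using IH by (intro stack.prems[of "Vs(Suc d := V')" "Es(Suc d := E')"]) (auto simp: V'_def E'_def)
qed

section \<open>Addresses in \<open>k\<close>-ary trees\<close>

lemma walk_append_edge:
  assumes "walk V E u xs v" "{v,w} \<in> E" "w \<in> V"
  shows "walk V E u (xs @ [w]) w"
  using assms unfolding walk_def by (auto simp: successively_append_iff)

text \<open>The stretch between two occurrences of a vertex can be cut out, which shortens the
  walk.\<close>

lemma walk_distinct:
  assumes "walk V E u xs v"
  obtains ys where "walk V E u ys v" "distinct ys"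
  using assms
proof (induction xs arbitrary: thesis rule: length_induct)
  case (1 xs)
  show ?case
  proof (cases "distinct xs")
    case True
    then show ?thesis using 1 by blast
  next
    case False
    then obtain as y bs cs where xs: "xs = as @ [y] @ bs @ [y] @ cs"
      using not_distinct_decomp by blast
    have "walk V E u (as @ [y] @ cs) v"
      using 1(3) unfolding walk_def xs
      by (auto simp: successively_append_iff successively_Cons hd_append split: if_splits)
    moreover have "length (as @ [y] @ cs) < length xs" using xs by simp
    ultimately show ?thesis using 1 by blast
  qed
qed

lemma walk_rev:
  assumes "walk V E u xs v"
  shows "walk V E v (rev xs) u"
  using assms unfolding walk_def by (auto simp: insert_commute hd_rev last_rev)

lemma walk_trans:
  assumes "walk V E u xs v" "walk V E v ys w"
  shows "walk V E u (xs @ tl ys) w"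
  using assms unfolding walk_def
  by (cases ys) (auto simp: successively_append_iff successively_Cons)

lemma level_le: "walk V E r xs v \<Longrightarrow> length xs = Suc l \<Longrightarrow> level V E r v \<le> l"
  unfolding level_def by (rule Least_le) blast

lemma level_walk:
  assumes "walk V E r xs v"
  obtains ys where "walk V E r ys v" "length ys = Suc (level V E r v)"
proof -
  have "length xs = Suc (length xs - 1)" using assms by (cases xs) (auto simp: walk_def)
  then have "\<exists>l ys. walk V E r ys v \<and> length ys = Suc l" using assms by blast
  from LeastI_ex[OF this] show ?thesis using that unfolding level_def by blast
qed

lemma level_root: "r \<in> V \<Longrightarrow> level V E r r = 0"
  using level_le[of V E r "[r]" r 0] by (simp add: walk_def)

text \<open>The parent is the vertex before \<open>v\<close> on a shortest walk from
  \<open>r\<close>. Cutting off \<open>v\<close> bounds its level from above, and appending the edge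
  to \<open>v\<close> bounds it from below.\<close>

lemma exists_parent:
  assumes con: "connected_graph V E" and "r \<in> V" "v \<in> V" "v \<noteq> r"
  obtains u where "u \<in> V" "v \<in> children V E r u"
proof -
  obtain xs where "walk V E r xs v" using assms unfolding connected_graph_def by blast
  then obtain ys where ys: "walk V E r ys v" "length ys = Suc (level V E r v)" by (rule level_walk)
  define zs where "zs = butlast ys"
  have ys_eq: "ys = zs @ [v]"
    using ys(1) append_butlast_last_id[of ys] unfolding walk_def zs_def by metis
  have "zs \<noteq> []" using ys(1) \<open>v \<noteq> r\<close> unfolding ys_eq walk_def by auto
  then have zs: "walk V E r zs (last zs)" and e: "{last zs, v} \<in> E"
    using ys(1) unfolding ys_eq walk_def by (auto simp: successively_append_iff)
  have len: "length zs = level V E r v" using ys(2) ys_eq by simp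
  then have pos: "level V E r v > 0" using \<open>zs \<noteq> []\<close> by (metis length_greater_0_conv)
  then have "level V E r (last zs) \<le> level V E r v - 1"
    using len by (intro level_le[OF zs]) simp
  moreover have "level V E r v \<le> Suc (level V E r (last zs))"
  proof -
    obtain ws where ws: "walk V E r ws (last zs)" "length ws = Suc (level V E r (last zs))"
      using level_walk[OF zs] .
    show ?thesis using level_le[OF walk_append_edge[OF ws(1) e \<open>v \<in> V\<close>]] ws(2) by simp
  qed
  moreover have "last zs \<in> V" using zs \<open>zs \<noteq> []\<close> unfolding walk_def by auto
  ultimately show ?thesis using that[of "last zs"] pos e \<open>v \<in> V\<close> unfolding children_def by simp
qed

text \<open>The parent edges alone connect the graph, so any other edge would close a cycle.\<close>

lemma tree_edge_parent:
  assumes t: "tree V E" and r: "r \<in> V" and e: "{u,w} \<in> E"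
    and par: "\<And>v. v \<in> V \<Longrightarrow> v \<noteq> r \<Longrightarrow> par v \<in> V \<and> v \<in> children V E r (par v)"
  shows "u \<in> V \<and> w \<in> V \<and> (w \<noteq> r \<and> u = par w \<or> u \<noteq> r \<and> w = par u)"
proof -
  define P where "P = {{par x, x} | x. x \<in> V \<and> x \<noteq> r}"
  have acyc: "\<nexists>xs. graph_cycle V E xs"
    and sg: "simple_graph V E" using t unfolding tree_def by auto
  have PE: "P \<subseteq> E" using par unfolding P_def children_def by auto
  \<comment> \<open>Following parents lowers the level and so ends at the root.\<close>
  have to_root: "\<exists>xs. walk V P r xs v" if "v \<in> V" for v
    using that
  proof (induction "level V E r v" arbitrary: v rule: less_induct)
    case less
    show ?case
    proof (cases "v = r")
      case True
      then show ?thesis using r by (intro exI[of _ "[r]"]) (simp add: walk_def)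
    next
      case False
      note pv = par[OF less.prems False]
      then have "level V E r (par v) < level V E r v" by (simp add: children_def)
      then obtain xs where "walk V P r xs (par v)" using less.hyps pv by blast
      moreover have "{par v,v} \<in> P" using less.prems False unfolding P_def by blast
      ultimately have "walk V P r (xs @ [v]) v" using less.prems by (rule walk_append_edge)
      then show ?thesis by blast
    qed
  qed
  have "{u,w} \<subseteq> V" "card {u,w} = 2"
    using sg e unfolding simple_graph_def by auto
  then have uw: "u \<in> V" "w \<in> V" "u \<noteq> w" by auto
  have "{u,w} \<in> P"
  proof (rule ccontr)
    assume nP: "{u,w} \<notin> P"
    obtain xs where xs: "walk V P r xs u" using to_root uw by blast
    obtain ys where ys: "walk V P r ys w" using to_root uw by blast
    \<comment> \<open>The route from \<open>u\<close> to the root and on to \<open>w\<close> uses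
      parent edges only; freed of repetitions, it is closed to a cycle by
      \<open>{u,w}\<close>.\<close>
    have "walk V P u (rev xs @ tl ys) w" by (rule walk_trans[OF walk_rev[OF xs] ys])
    then obtain zs where zs: "walk V P u zs w" "distinct zs" by (rule walk_distinct)
    \<comment> \<open>One vertex would give \<open>u = w\<close>, and two would put
      \<open>{u,w}\<close> into \<open>P\<close>.\<close>
    have "length zs \<ge> 3"
    proof (rule ccontr)
      assume "\<not> length zs \<ge> 3"
      then have "length zs = 0 \<or> length zs = 1 \<or> length zs = 2" by linarith
      then consider "zs = []" | x where "zs = [x]" | x y where "zs = [x,y]"
        by (auto simp: length_Suc_conv numeral_2_eq_2)
      then show False
        using zs(1) uw nP by cases (auto simp: walk_def)
    qed
    moreover have "successively (\<lambda>x y. {x,y} \<in> E) zs"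
      using zs(1) PE unfolding walk_def by (auto elim!: successively_mono)
    ultimately have "graph_cycle V E zs"
      using zs e unfolding graph_cycle_def walk_def by (simp add: insert_commute)
    then show False using acyc by blast
  qed
  then show ?thesis using uw unfolding P_def by (auto simp: doubleton_eq_iff)
qed

text \<open>The address of a vertex lists the child indices along the path from the root.\<close>

lemma kary_tree_addresses:
  assumes kt: "kary_tree k h V E r" and k: "k > 0"
  obtains addr :: "'a \<Rightarrow> nat list" where "inj_on addr V"
    "\<And>v. v \<in> V \<Longrightarrow> set (addr v) \<subseteq> {..<k} \<and> length (addr v) \<le> h"
    "\<And>u w. {u,w} \<in> E \<Longrightarrow> \<exists>j. addr w = addr u @ [j] \<or> addr u = addr w @ [j]"
proof -
  let ?lv = "level V E r" and ?ch = "children V E r"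
  have t: "tree V E" and r: "r \<in> V" and con: "connected_graph V E"
    using kt unfolding kary_tree_def tree_def by auto
  have leaf: "?ch v = {}" if "v \<in> V" "?lv v = h" for v
    using kt that unfolding kary_tree_def by auto
  \<comment> \<open>Having no children or exactly \<open>k > 0\<close> of them makes
    \<open>?ch v\<close> finite, so the children can be numbered below \<open>k\<close>.\<close>
  have "\<forall>v\<in>V. \<exists>idx. inj_on idx (?ch v) \<and> idx ` ?ch v \<subseteq> {..<k}"
  proof
    fix v assume "v \<in> V"
    then have c: "?ch v = {} \<or> card (?ch v) = k" using kt unfolding kary_tree_def by metis
    then have "finite (?ch v)" using k card_ge_0_finite by fastforce
    moreover have "card (?ch v) \<le> card {..<k}" using c by auto
    ultimately show "\<exists>idx. inj_on idx (?ch v) \<and> idx ` ?ch v \<subseteq> {..<k}"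
      using card_le_inj[of "?ch v" "{..<k}"] by auto
  qed
  then obtain idx where idx: "\<And>v. v \<in> V \<Longrightarrow> inj_on (idx v) (?ch v) \<and> idx v ` ?ch v \<subseteq> {..<k}"
    by metis
  have "\<forall>v\<in>V - {r}. \<exists>u. u \<in> V \<and> v \<in> ?ch u" using exists_parent[OF con r] by (metis DiffE singletonI)
  then obtain par where par: "\<And>v. v \<in> V \<Longrightarrow> v \<noteq> r \<Longrightarrow> par v \<in> V \<and> v \<in> ?ch (par v)"
    by (metis DiffI singletonD)
  have lev: "?lv v = Suc (?lv (par v))" if "v \<in> V" "v \<noteq> r" for v
    using par[OF that] by (simp add: children_def)
  have lev0: "?lv v = 0 \<longleftrightarrow> v = r" if "v \<in> V" for v
    using lev[OF that] level_root[OF r] by (metis nat.distinct(1))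
  \<comment> \<open>The recursion climbs to the parent, with the level as the counter that makes it
    primitive recursive; \<open>addr_child\<close> is the equation wanted.\<close>
  define go where "go = rec_nat (\<lambda>v. []) (\<lambda>_ rec v. rec (par v) @ [idx (par v) v])"
  define addr where "addr v = go (?lv v) v" for v
  have addr_r: "addr r = []" by (simp add: addr_def go_def level_root r)
  have addr_child: "addr v = addr (par v) @ [idx (par v) v]" if "v \<in> V" "v \<noteq> r" for v
    using lev[OF that] by (simp add: addr_def go_def)
  \<comment> \<open>By induction the parent is on level at most \<open>h\<close>, and having a child
    it is not on level \<open>h\<close> itself.\<close>
  have lev_h: "?lv v \<le> h" if "v \<in> V" for v
    using that
  proof (induction "?lv v" arbitrary: v)
    case (Suc l)
    then have "v \<noteq> r" using lev0 by (metis nat.distinct(1))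
    note pv = par[OF Suc.prems this] lev[OF Suc.prems this]
    then have "?lv (par v) \<le> h" using Suc by auto
    moreover have "?lv (par v) \<noteq> h" using leaf[of "par v"] pv by auto
    ultimately show ?case using pv by simp
  qed simp
  have len: "length (addr v) = ?lv v \<and> set (addr v) \<subseteq> {..<k}" if "v \<in> V" for v
    using that
  proof (induction "?lv v" arbitrary: v)
    case 0
    then show ?case using lev0 addr_r by auto
  next
    case (Suc l)
    then have "v \<noteq> r" using lev0 by (metis nat.distinct(1))
    note pv = par[OF Suc.prems this] lev[OF Suc.prems this] addr_child[OF Suc.prems this]
    then show ?case using Suc.hyps(1)[of "par v"] Suc.hyps(2) idx[of "par v"] by auto
  qed
  \<comment> \<open>Equal addresses have equal length, hence equal level. By induction the parents
    agree, and siblings have distinct indices.\<close>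
  have inj: "v = w" if "v \<in> V" "w \<in> V" "addr v = addr w" for v w
    using that
  proof (induction "?lv v" arbitrary: v w)
    case 0
    then show ?case using len lev0 by metis
  next
    case (Suc l)
    then have ne: "v \<noteq> r" "w \<noteq> r" using len lev0 by (metis nat.distinct(1))+
    have eq: "addr (par v) = addr (par w)" "idx (par v) v = idx (par w) w"
      using addr_child[OF Suc.prems(1) ne(1)] addr_child[OF Suc.prems(2) ne(2)] Suc.prems(3) by auto
    have "par v = par w"
      using Suc.hyps(1)[of "par v" "par w"] Suc.hyps(2) eq par ne Suc.prems lev by auto
    then show ?case using eq par[OF Suc.prems(1) ne(1)] par[OF Suc.prems(2) ne(2)] idx[of "par v"]
      by (auto dest: inj_onD)
  qed
  show ?thesis
  proof
    show "inj_on addr V" using inj by (rule inj_onI)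
    show "set (addr v) \<subseteq> {..<k} \<and> length (addr v) \<le> h" if "v \<in> V" for v
      using len[OF that] lev_h[OF that] by simp
    show "\<exists>j. addr w = addr u @ [j] \<or> addr u = addr w @ [j]" if "{u,w} \<in> E" for u w
    proof -
      have uw: "u \<in> V \<and> w \<in> V \<and> (w \<noteq> r \<and> u = par w \<or> u \<noteq> r \<and> w = par u)"
        using t r that par by (rule tree_edge_parent)
      then consider "w \<in> V" "w \<noteq> r" "u = par w" | "u \<in> V" "u \<noteq> r" "w = par u" by blast
      then show ?thesis
      proof cases
        case 1
        then show ?thesis using addr_child[OF 1(1,2)] by blast
      next
        case 2
        then show ?thesis using addr_child[OF 2(1,2)] by blast
      qed
    qed
  qed
qed

section \<open>Choice of the depth per level\<close>

text \<open>The largest power of two up to \<open>k ^ 2\<close> exceeds half of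
  \<open>k ^ 2\<close>, which is at least \<open>3 * k / 2\<close> for \<open>k \<ge> 3\<close>; for
  \<open>k = 2\<close> the power 4 serves.\<close>

lemma square_power_of_two:
  fixes k :: nat
  assumes "k \<ge> 2"
  obtains i where "2 ^ i \<le> k ^ 2" "k < 2 ^ i"
proof (cases "k = 2")
  case True
  then show ?thesis using that[of 2] by simp
next
  case False
  then have k: "k \<ge> 3" using assms by simp
  obtain i where i: "2 ^ i \<le> k ^ 2" "k ^ 2 < 2 ^ Suc i"
    using ex_power_ivl1[of 2 "k ^ 2"] k by auto
  have "3 * k \<le> k ^ 2" using k by (simp add: power2_eq_square)
  then have "k < 2 ^ i" using i(2) k by simp
  then show ?thesis using that i(1) by blast
qed

theorem proposition3:
  fixes k n h :: nat
    and o1 o2 o3 :: "real^2"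
    and V :: "(real^2) set" and E :: "(real^2) set set"
    and W :: "'a set" and F :: "'a set set" and r :: 'a
  assumes "k \<ge> 2" and "n \<ge> 1"
    and "uniformly_stacked o1 o2 o3 (nat \<lceil>2 * log 2 (real n)\<rceil>) V E"
    and "kary_tree k h W F r"
    and "real h \<le> log (real k) (real n)"
  shows "contained_as_subgraph W F V E"
proof -
  define d where "d = nat \<lceil>2 * log 2 (real n)\<rceil>"
  obtain i where i: "2 ^ i \<le> k ^ 2" "k < 2 ^ i" using square_power_of_two[OF \<open>k \<ge> 2\<close>] .
  have "real h * i \<le> 2 * log 2 n"
  proof -
    have "real i \<le> 2 * log 2 k"
    proof -
      have "real (2 ^ i) \<le> real (k ^ 2)" using i(1) by (simp only: of_nat_le_iff)
      then have "log 2 (2 ^ i) \<le> log 2 (real k ^ 2)"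
        using \<open>k \<ge> 2\<close> by (subst log_le_cancel_iff) auto
      then show ?thesis using \<open>k \<ge> 2\<close> by (simp add: log_nat_power)
    qed
    then have "real h * i \<le> log k n * (2 * log 2 k)"
      using assms(5) by (intro mult_mono) auto
    \<comment> \<open>Change of base: \<open>log k n * log 2 k = log 2 n\<close>.\<close>
    also have "\<dots> = 2 * log 2 n" using \<open>k \<ge> 2\<close> by (simp add: log_def)
    finally show ?thesis .
  qed
  then have hd: "h * i \<le> d" unfolding d_def using real_nat_ceiling_ge[of "2 * log 2 (real n)"]
    by (metis of_nat_le_iff of_nat_mult order_trans)
  obtain Vs Es where nc: "\<not> collinear {o1,o2,o3}"
    and st: "Vs 0 = {o1,o2,o3}" "Es 0 = {{o1,o2},{o2,o3},{o3,o1}}" "Vs d = V" "Es d = E"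
    "\<And>t. t < d \<Longrightarrow> \<exists>p. stacking_step p (Vs t) (Es t) (Vs (Suc t)) (Es (Suc t))"
    using uniformly_stacked_stages[OF assms(3)] unfolding d_def by metis
  interpret stacking Vs Es d
    using st(5) triangle_triangulated(2)[OF nc] by unfold_locales (auto simp: st)
  have "triangular_face (Vs 0) (Es 0) (interior (convex hull {o1,o2,o3})) o1 o2 o3"
    unfolding st by (rule triangle_triangulated(1)[OF nc])
  then obtain \<phi> where \<phi>: "inj_on \<phi> {xs. set xs \<subseteq> {..<k} \<and> length xs \<le> h}"
    "\<And>xs. set xs \<subseteq> {..<k} \<Longrightarrow> length xs \<le> h \<Longrightarrow> \<phi> xs \<in> Vs (h * i)"
    "\<And>xs j. set (xs @ [j]) \<subseteq> {..<k} \<Longrightarrow> length (xs @ [j]) \<le> h \<Longrightarrow> {\<phi> xs, \<phi> (xs @ [j])} \<in> Es (h * i)"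
    using address_tree_embedding[OF i(2), of 0 h] hd by (metis (no_types, lifting) IntD2 add_0)
  \<comment> \<open>The embedding is complete at stage \<open>h * i\<close>; later stages up to
    \<open>d\<close> only add vertices and edges.\<close>
  have sub: "Vs (h * i) \<subseteq> V" "Es (h * i) \<subseteq> E" using mono[OF hd] st(3,4) by auto
  obtain addr where addr: "inj_on addr W"
    "\<And>v. v \<in> W \<Longrightarrow> set (addr v) \<subseteq> {..<k} \<and> length (addr v) \<le> h"
    "\<And>u w. {u,w} \<in> F \<Longrightarrow> \<exists>j. addr w = addr u @ [j] \<or> addr u = addr w @ [j]"
    using kary_tree_addresses[OF assms(4)] \<open>k \<ge> 2\<close> by (metis less_le_trans pos2)
  have "addr ` W \<subseteq> {xs. set xs \<subseteq> {..<k} \<and> length xs \<le> h}" using addr(2) by blast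
  then have "inj_on (\<phi> \<circ> addr) W"
    using addr(1) \<phi>(1) by (meson comp_inj_on inj_on_subset)
  moreover have "(\<phi> \<circ> addr) ` W \<subseteq> V" using addr(2) \<phi>(2) sub(1) by fastforce
  moreover have "{(\<phi> \<circ> addr) u, (\<phi> \<circ> addr) w} \<in> E" if e: "{u,w} \<in> F" for u w
  proof -
    have "{u,w} \<subseteq> W"
      using assms(4) e unfolding kary_tree_def tree_def simple_graph_def by blast
    then have uw: "u \<in> W" "w \<in> W" by auto
    obtain j where "addr w = addr u @ [j] \<or> addr u = addr w @ [j]" using addr(3)[OF e] by blast
    then have "{(\<phi> \<circ> addr) u, (\<phi> \<circ> addr) w} \<in> Es (h * i)"
      using \<phi>(3)[of "addr u" j] \<phi>(3)[of "addr w" j] addr(2)[OF uw(1)] addr(2)[OF uw(2)]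
      by (auto simp: insert_commute)
    then show ?thesis using sub(2) by blast
  qed
  ultimately show ?thesis unfolding contained_as_subgraph_def by blast
qed

end
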